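(* Suppose that $0<\epsilon<\frac{1}{\sqrt{17}}$, $0<\delta<\frac{1}{\sqrt{17}}$ and $C\ge 6$. For any positive integer $T<+\infty$ and any integer $d\ge T+1$, $$\inf_{A\in\mathcal{A}_{\mathrm{det}}}\ \sup_{f\in\mathcal{F}^{\mathrm{Lip}}_{C,d}}\ \min_{t\in\{1,\dots,T\}}\ \mathrm{dist}\Big(0,\partial_\delta f\big(x^{A[f],(t)}\big)\Big)>\epsilon .$$
   Context: Norms are Euclidean. $\mathbb{B}_r(x)=\{v:\|v-x\|\le r\}$ is the closed ball, and $\mathrm{dist}(x,S)=\inf_{v\in S}\|v-x\|$. $\|f\|_{\mathrm{Lip}}$ is the Lipschitz constant of $f$. Subdifferentials. For a Lipschitz function $f:\mathbb{R}^n\to\mathbb{R}$, the Clarke subdifferential at $x$ is $\partial f(x)=\mathrm{Conv}\{s:\exists\, x'\to x,\ \nabla f(x')\text{ exists},\ \nabla f(x')\to s\}$. For $\delta\ge 0$, the Goldstein $\delta$-subdifferential at $x$ is $\partial_\delta f(x)=\mathrm{Conv}\big(\bigcup_{y\in\mathbb{B}_\delta(x)}\partial f(y)\big)$. Function class. For $C>0$ and a positive integer $d$, $\mathcal{F}^{\mathrm{Lip}}_{C,d}$ is the set of all $f:\mathbb{R}^{d'}\to\mathbb{R}$ with $d'\in\{1,\dots,d\}$, $\|f\|_{\mathrm{Lip}}\le C$ and $f(0)-\inf_x f(x)\le C$. Local oracle. Given $F:\mathbb{R}^n\to\mathbb{R}$ and a query point $x\in\mathbb{R}^n$, a local oracle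 returns a function $\mathcal{O}_F(x):\mathbb{R}^n\to\mathbb{R}$ for which there exists $\nu>0$ with $F(y)=\mathcal{O}_F(x)(y)$ for all $y\in\mathbb{B}_\nu(x)$. The radius $\nu$ is not returned. Algorithms. An algorithm $A$, applied to a Lipschitz function $F:\mathbb{R}^n\to\mathbb{R}$ ($n$ any positive integer), generates a sequence $\big(x^{A[F],(t)}\big)_{t\ge1}$ of points of $\mathbb{R}^n$. $\mathcal{A}_{\mathrm{det}}$ is the class of deterministic algorithms using only local information at current and past points, i.e. those $A$ such that for all functions $F,G$ on the same $\mathbb{R}^n$ and all integers $t\ge0$: if there exists $\nu>0$ with $\mathcal{O}_F\big(x^{A[F],(i)}\big)(y)=\mathcal{O}_G\big(x^{A[F],(i)}\big)(y)$ for all $i\in\{1,\dots,t\}$ and all $y\in\mathbb{B}_\nu\big(x^{A[F],(i)}\big)$, then $x^{A[F],(j)}=x^{A[G],(j)}$ for all $j\in\{1,\dots,t+1\}$. (For $t=0$ this says that the first iterate does not depend on the function.) *)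

theory Defs
  imports "HOL-Analysis.Analysis" "HOL-Library.Poly_Mapping"
begin

text \<open>
  Dimensions vary inside the statement: one algorithm acts in every dimension, and the
  supremum ranges over functions of \<open>1, \<dots>, d\<close> variables. All spaces \<open>\<real>\<^sup>n\<close> are therefore
  realised inside a single inner product space, the finitely supported real sequences
  \<open>nat \<Rightarrow>\<^sub>0 real\<close>, as the subspaces of sequences vanishing at all indices \<open>k \<ge> n\<close>.
\<close>

instantiation poly_mapping :: (type, real_vector) real_vector
begin

lift_definition scaleR_poly_mapping :: "real \<Rightarrow> ('a \<Rightarrow>\<^sub>0 'b) \<Rightarrow> ('a \<Rightarrow>\<^sub>0 'b)"
  is "\<lambda>r f k. r *\<^sub>R f k"
  by (erule rev_finite_subset) auto

instance
  by standard (transfer; simp add: fun_eq_iff scaleR_add_right scaleR_add_left)+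

end

lemma lookup_scaleR [simp]: "Poly_Mapping.lookup (r *\<^sub>R x) k = r *\<^sub>R Poly_Mapping.lookup x k"
  by (fact scaleR_poly_mapping.rep_eq[THEN fun_cong])

instantiation poly_mapping :: (type, real_inner) real_inner
begin

definition inner_poly_mapping :: "('a \<Rightarrow>\<^sub>0 'b) \<Rightarrow> ('a \<Rightarrow>\<^sub>0 'b) \<Rightarrow> real"
  where "inner_poly_mapping x y = (\<Sum>k\<in>Poly_Mapping.keys x. Poly_Mapping.lookup x k \<bullet> Poly_Mapping.lookup y k)"

definition norm_poly_mapping :: "('a \<Rightarrow>\<^sub>0 'b) \<Rightarrow> real"
  where "norm_poly_mapping x = sqrt (x \<bullet> x)"

definition dist_poly_mapping :: "('a \<Rightarrow>\<^sub>0 'b) \<Rightarrow> ('a \<Rightarrow>\<^sub>0 'b) \<Rightarrow> real"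
  where "dist_poly_mapping x y = norm (x - y)"

definition sgn_poly_mapping :: "('a \<Rightarrow>\<^sub>0 'b) \<Rightarrow> ('a \<Rightarrow>\<^sub>0 'b)"
  where "sgn_poly_mapping x = x /\<^sub>R norm x"

definition uniformity_poly_mapping :: "(('a \<Rightarrow>\<^sub>0 'b) \<times> ('a \<Rightarrow>\<^sub>0 'b)) filter"
  where "uniformity_poly_mapping = (INF e\<in>{0<..}. principal {(x, y). dist x y < e})"

definition open_poly_mapping :: "('a \<Rightarrow>\<^sub>0 'b) set \<Rightarrow> bool"
  where "open_poly_mapping U \<longleftrightarrow>
    (\<forall>x\<in>U. eventually (\<lambda>(x', y). x' = x \<longrightarrow> y \<in> U) uniformity)"

lemma inner_poly_mapping_superset:
  assumes "finite A" "Poly_Mapping.keys x \<subseteq> A"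
  shows "x \<bullet> y = (\<Sum>k\<in>A. Poly_Mapping.lookup x k \<bullet> Poly_Mapping.lookup y k)"
  unfolding inner_poly_mapping_def
  using assms by (intro sum.mono_neutral_left) (auto simp: in_keys_iff)

instance
proof
  fix x y z :: "'a \<Rightarrow>\<^sub>0 'b" and r :: real
  let ?A = "Poly_Mapping.keys x \<union> Poly_Mapping.keys y"
  have keys_add: "Poly_Mapping.keys (x + y) \<subseteq> ?A"
    by (rule Poly_Mapping.keys_add)
  have keys_scale: "Poly_Mapping.keys (r *\<^sub>R x) \<subseteq> Poly_Mapping.keys x"
    by (auto simp: in_keys_iff)
  show "dist x y = norm (x - y)"
    by (fact dist_poly_mapping_def)
  show "sgn x = x /\<^sub>R norm x"
    by (fact sgn_poly_mapping_def)
  show "uniformity = (INF e\<in>{0<..}. principal {(x :: 'a \<Rightarrow>\<^sub>0 'b, y). dist x y < e})"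
    by (fact uniformity_poly_mapping_def)
  show "open U \<longleftrightarrow> (\<forall>x\<in>U. eventually (\<lambda>(x', y). x' = x \<longrightarrow> y \<in> U) uniformity)"
    for U :: "('a \<Rightarrow>\<^sub>0 'b) set"
    by (fact open_poly_mapping_def)
  show "x \<bullet> y = y \<bullet> x"
    by (simp add: inner_poly_mapping_superset[of ?A] inner_commute)
  show "(x + y) \<bullet> z = x \<bullet> z + y \<bullet> z"
    by (simp add: inner_poly_mapping_superset[of ?A] keys_add lookup_add inner_add_left
        sum.distrib)
  show "(r *\<^sub>R x) \<bullet> y = r * (x \<bullet> y)"
    by (simp add: inner_poly_mapping_superset[of "Poly_Mapping.keys x"] keys_scale sum_distrib_left)
  show "0 \<le> x \<bullet> x"
    by (simp add: inner_poly_mapping_def sum_nonneg)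
  show "x \<bullet> x = 0 \<longleftrightarrow> x = 0"
    by (auto simp: inner_poly_mapping_def sum_nonneg_eq_0_iff in_keys_iff
        intro: poly_mapping_eqI)
  show "norm x = sqrt (x \<bullet> x)"
    by (fact norm_poly_mapping_def)
qed

end

type_synonym vec = "nat \<Rightarrow>\<^sub>0 real"

definition Rn :: "nat \<Rightarrow> vec set"
  where "Rn n = {x. Poly_Mapping.keys x \<subseteq> {..<n}}"

text \<open>
  A function \<open>\<real>\<^sup>n \<rightarrow> \<real>\<close> is represented by some \<open>f :: vec \<Rightarrow> real\<close>; its values outside
  \<open>Rn n\<close> are irrelevant. In particular the derivative is taken within \<open>Rn n\<close>, where it is
  unique because \<open>Rn n\<close> is a subspace, and balls are intersected with \<open>Rn n\<close>.
\<close>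

definition has_gradient :: "nat \<Rightarrow> (vec \<Rightarrow> real) \<Rightarrow> vec \<Rightarrow> vec \<Rightarrow> bool"
  where "has_gradient n f x g \<longleftrightarrow>
    g \<in> Rn n \<and> (f has_derivative (\<lambda>h. g \<bullet> h)) (at x within Rn n)"

definition clarke :: "nat \<Rightarrow> (vec \<Rightarrow> real) \<Rightarrow> vec \<Rightarrow> vec set"
  where "clarke n f x = convex hull {s \<in> Rn n. \<exists>X G.
    (\<forall>k. X k \<in> Rn n \<and> has_gradient n f (X k) (G k)) \<and> X \<longlonglongrightarrow> x \<and> G \<longlonglongrightarrow> s}"

definition goldstein :: "nat \<Rightarrow> real \<Rightarrow> (vec \<Rightarrow> real) \<Rightarrow> vec \<Rightarrow> vec set"
  where "goldstein n \<delta> f x = convex hull (\<Union>y \<in> cball x \<delta> \<inter> Rn n. clarke n f y)"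

text \<open>The extended reals make the second condition fail when \<open>f\<close> is unbounded below.\<close>

definition lip_class :: "real \<Rightarrow> nat \<Rightarrow> (nat \<times> (vec \<Rightarrow> real)) set"
  where "lip_class C d = {(n, f). n \<in> {1..d} \<and> C-lipschitz_on (Rn n) f \<and>
    ereal (f 0) - (INF x\<in>Rn n. ereal (f x)) \<le> ereal C}"

text \<open>\<open>orc n F x\<close> is the function on \<open>\<real>\<^sup>n\<close> that the oracle returns for \<open>F\<close> at the query point \<open>x\<close>.\<close>

definition local_oracle :: "(nat \<Rightarrow> (vec \<Rightarrow> real) \<Rightarrow> vec \<Rightarrow> vec \<Rightarrow> real) \<Rightarrow> bool"
  where "local_oracle orc \<longleftrightarrow> (\<forall>n\<ge>1. \<forall>F. \<forall>x\<in>Rn n.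
    \<exists>\<nu>>0. \<forall>y \<in> cball x \<nu> \<inter> Rn n. F y = orc n F x y)"

definition is_lipschitz :: "nat \<Rightarrow> (vec \<Rightarrow> real) \<Rightarrow> bool"
  where "is_lipschitz n F \<longleftrightarrow> (\<exists>L. L-lipschitz_on (Rn n) F)"

text \<open>
  \<open>A n F t\<close> is the \<open>t\<close>-th iterate, \<open>t \<ge> 1\<close>, of the algorithm \<open>A\<close> applied to the Lipschitz
  function \<open>F\<close> on \<open>\<real>\<^sup>n\<close>; nothing is required of \<open>A\<close> at \<open>n = 0\<close>, at \<open>t = 0\<close> or at functions
  that are not Lipschitz.
\<close>

definition det_algorithms ::
    "(nat \<Rightarrow> (vec \<Rightarrow> real) \<Rightarrow> vec \<Rightarrow> vec \<Rightarrow> real) \<Rightarrow> (nat \<Rightarrow> (vec \<Rightarrow> real) \<Rightarrow> nat \<Rightarrow> vec) set"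
  where "det_algorithms orc = {A. \<forall>n\<ge>1.
    (\<forall>F. is_lipschitz n F \<longrightarrow> (\<forall>t\<ge>1. A n F t \<in> Rn n)) \<and>
    (\<forall>F G. is_lipschitz n F \<longrightarrow> is_lipschitz n G \<longrightarrow> (\<forall>t.
      (\<exists>\<nu>>0. \<forall>i\<in>{1..t}. \<forall>y \<in> cball (A n F i) \<nu> \<inter> Rn n.
         orc n F (A n F i) y = orc n G (A n F i) y)
      \<longrightarrow> (\<forall>j\<in>{1..t + 1}. A n F j = A n G j)))}"

end

theory Submission
  imports Defs
begin

text \<open>
  The adversary shows the algorithm the same picture at every query: near each query point \<open>s\<close>
  the function is the affine function \<open>\<lambda>y. e \<bullet> (y - s)\<close>, where \<open>e\<close> is the first unit vector.
  Such answers are possible for any finite set of query points, so the algorithm is led along a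
  sequence \<open>s\<^sub>1, \<dots>, s\<^sub>T\<close> which carries no information beyond \<open>e\<close>. In dimension \<open>T + 1\<close> there is
  a unit vector \<open>v\<close> orthogonal to \<open>e\<close> and to the \<open>T - 1\<close> differences \<open>s\<^sub>i - s\<^sub>1\<close>. The function
  \<open>\<lambda>x. v \<bullet> (x - s\<^sub>1)\<close> vanishes at all query points, and it can be altered in small balls
  around them so as to show the affine picture above (\<open>patched_near\<close>). The alteration only takes
  maxima and minima of \<open>\<lambda>y. e \<bullet> (y - s)\<close>, of \<open>\<lambda>x. v \<bullet> (x - s\<^sub>1)\<close>, and of the latter plus or
  minus a cone of slope \<open>1/3\<close>.

  All these pieces grow at rate at least \<open>1/2\<close> in the direction \<open>e + v\<close>, and maxima and minima
  keep such a lower bound on increments; so the altered function grows at that rate too, and it is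
  \<open>4/3\<close>-Lipschitz for the same reason (\<open>patched_increment\<close>). Every gradient \<open>g\<close> therefore
  satisfies \<open>g \<bullet> (e + v) \<ge> 1/2\<close>, a half-space condition that survives limits and convex hulls, and
  as \<open>norm (e + v) \<le> 3/2\<close> the Goldstein subdifferentials stay at distance at least \<open>1/3\<close> from
  \<open>0\<close> (\<open>infdist_goldstein_ge\<close>). Finally, cutting the function off at the levels \<open>-1\<close> and \<open>1\<close>
  makes \<open>f 0 - inf f\<close> at most \<open>2\<close>. Since the function vanishes at the queries and is
  \<open>4/3\<close>-Lipschitz, the cut-off changes nothing within distance \<open>3/4\<close> of a query, hence nothing in
  the \<open>\<delta>\<close>-balls that matter. The bound \<open>1/3\<close> does not depend on the algorithm and exceeds
  \<open>1 / sqrt 17\<close>, which gives the strict inequality for the infimum.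
\<close>

section \<open>Increments of lattice polynomials\<close>

lemma Max_increment:
  fixes g :: "'b \<Rightarrow> 'a \<Rightarrow> real"
  assumes "finite S" "S \<noteq> {}" "\<And>s. s \<in> S \<Longrightarrow> g s x + c \<le> g s y"
  shows "Max ((\<lambda>s. g s x) ` S) + c \<le> Max ((\<lambda>s. g s y) ` S)"
proof -
  have "Max ((\<lambda>s. g s x) ` S) \<in> (\<lambda>s. g s x) ` S"
    using assms by (intro Max_in) auto
  then obtain s where s: "s \<in> S" "Max ((\<lambda>s. g s x) ` S) = g s x"
    by blast
  have "g s y \<le> Max ((\<lambda>s. g s y) ` S)"
    using assms s by (intro Max_ge) auto
  with assms(3)[OF s(1)] s(2) show ?thesis
    by linarith
qed

lemma Min_increment:
  fixes g :: "'b \<Rightarrow> 'a \<Rightarrow> real"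
  assumes "finite S" "S \<noteq> {}" "\<And>s. s \<in> S \<Longrightarrow> g s x + c \<le> g s y"
  shows "Min ((\<lambda>s. g s x) ` S) + c \<le> Min ((\<lambda>s. g s y) ` S)"
proof -
  have "Min ((\<lambda>s. g s y) ` S) \<in> (\<lambda>s. g s y) ` S"
    using assms by (intro Min_in) auto
  then obtain s where s: "s \<in> S" "Min ((\<lambda>s. g s y) ` S) = g s y"
    by blast
  have "Min ((\<lambda>s. g s x) ` S) \<le> g s x"
    using assms s by (intro Min_le) auto
  with assms(3)[OF s(1)] s(2) show ?thesis
    by linarith
qed

lemma lipschitz_on_of_increment:
  fixes f :: "'a::real_normed_vector \<Rightarrow> real"
  assumes "L \<ge> 0" "\<And>x y. f x - L * norm (y - x) \<le> f y"
  shows "L-lipschitz_on X f"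
proof (rule lipschitz_onI)
  show "dist (f x) (f y) \<le> L * dist x y" for x y
    using assms(2)[of x y] assms(2)[of y x]
    by (simp add: dist_norm norm_minus_commute abs_le_iff)
qed (fact assms(1))

section \<open>Prescribing the germs at finitely many points\<close>

definition ramp :: "'a::real_inner \<Rightarrow> 'a \<Rightarrow> 'a \<Rightarrow> real"
  where "ramp e s x = e \<bullet> (x - s)"

definition cone :: "real \<Rightarrow> 'a::real_inner \<Rightarrow> 'a \<Rightarrow> real"
  where "cone r s x = (r - dist x s) / 3"

text \<open>
  For a single point \<open>s\<close> and \<open>cone r s x \<ge> 0\<close> this is \<open>ramp e s x\<close> clamped to the interval of
  radius \<open>cone r s x\<close> around \<open>ramp v p x\<close>, and for \<open>cone r s x \<le> 0\<close> it is \<open>ramp v p x\<close>. With several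
  points, the maximum makes the corrections that lie above \<open>ramp v p\<close> and the minimum those
  below.
\<close>

definition patched :: "'a::real_inner \<Rightarrow> 'a \<Rightarrow> 'a \<Rightarrow> real \<Rightarrow> 'a set \<Rightarrow> 'a \<Rightarrow> real"
  where "patched e v p r S x =
    min (Max ((\<lambda>s. max (ramp v p x) (min (ramp e s x) (ramp v p x + cone r s x))) ` S))
        (Min ((\<lambda>s. max (ramp e s x) (ramp v p x - cone r s x)) ` S))"

lemma ramp_increment: "ramp e s y = ramp e s x + e \<bullet> (y - x)"
  by (simp add: ramp_def inner_diff_right)

lemma abs_cone_diff_le: "\<bar>cone r s y - cone r s x\<bar> \<le> norm (y - x) / 3"
proof -
  have "\<bar>dist y s - dist x s\<bar> \<le> dist y x"
    using dist_triangle[of y s x] dist_triangle[of x s y] by (simp add: dist_commute abs_le_iff)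
  then show ?thesis
    by (simp add: cone_def dist_norm abs_le_iff field_simps)
qed

text \<open>
  A lower bound for the increments of all pieces of a lattice polynomial is one for the increments
  of the polynomial. The two cases that matter are a multiple of \<open>- norm (y - x)\<close>, which gives a
  Lipschitz constant, and a positive multiple of the step along \<open>e + v\<close>, which bounds gradients
  away from \<open>0\<close>.
\<close>

lemma patched_increment:
  assumes "finite S" "S \<noteq> {}"
    and "c \<le> e \<bullet> (y - x)" "c \<le> v \<bullet> (y - x) - norm (y - x) / 3"
  shows "patched e v p r S x + c \<le> patched e v p r S y"
proof -
  have e: "ramp e s x + c \<le> ramp e s y" for s
    using assms(3) ramp_increment[of e s y x] by linarith
  have v: "ramp v p x + c \<le> ramp v p y"
    using assms(4) ramp_increment[of v p y x] norm_ge_zero[of "y - x"] by linarith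
  have plus: "ramp v p x + cone r s x + c \<le> ramp v p y + cone r s y"
   and minus: "ramp v p x - cone r s x + c \<le> ramp v p y - cone r s y" for s
    using assms(4) ramp_increment[of v p y x] abs_cone_diff_le[of r s y x] by linarith+
  have "Max ((\<lambda>s. max (ramp v p x) (min (ramp e s x) (ramp v p x + cone r s x))) ` S) + c
      \<le> Max ((\<lambda>s. max (ramp v p y) (min (ramp e s y) (ramp v p y + cone r s y))) ` S)"
    using e v plus
    by (intro Max_increment[where g = "\<lambda>s x. max (ramp v p x) (min (ramp e s x) (ramp v p x + cone r s x))"]
        assms(1,2)) (smt (verit))
  moreover have "Min ((\<lambda>s. max (ramp e s x) (ramp v p x - cone r s x)) ` S) + c
      \<le> Min ((\<lambda>s. max (ramp e s y) (ramp v p y - cone r s y)) ` S)"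
    using e minus
    by (intro Min_increment[where g = "\<lambda>s x. max (ramp e s x) (ramp v p x - cone r s x)"]
        assms(1,2)) (smt (verit))
  ultimately show ?thesis
    unfolding patched_def by linarith
qed

lemma patched_lipschitz:
  assumes "finite S" "S \<noteq> {}" "norm e \<le> 1" "norm v \<le> 1"
  shows "(4/3)-lipschitz_on X (patched e v p r S)"
proof (rule lipschitz_on_of_increment)
  fix x y :: 'a
  have "- norm (y - x) \<le> u \<bullet> (y - x)" if "norm u \<le> 1" for u :: 'a
  proof -
    have "\<bar>u \<bullet> (y - x)\<bar> \<le> norm u * norm (y - x)"
      by (rule Cauchy_Schwarz_ineq2)
    also have "\<dots> \<le> norm (y - x)"
      using that by (simp add: mult_left_le_one_le)
    finally show ?thesis
      by linarith
  qed
  from this[OF assms(3)] this[OF assms(4)]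
  show "patched e v p r S x - 4/3 * norm (y - x) \<le> patched e v p r S y"
    using patched_increment[OF assms(1,2), of "- 4/3 * norm (y - x)" e y x v p r]
      norm_ge_zero[of "y - x"] by (simp add: algebra_simps)
qed simp

text \<open>
  Within distance \<open>r/7\<close> of \<open>s\<close> the difference of the two ramps, which is at most
  \<open>2 * norm (y - s)\<close>, does not exceed \<open>cone r s y\<close>, so the clamping at \<open>s\<close> is inactive; the other
  centres are so far away that their terms do not interfere.
\<close>

lemma patched_near:
  assumes "finite S" "s \<in> S" "r > 0"
    and sep: "\<And>s'. s' \<in> S \<Longrightarrow> s' \<noteq> s \<Longrightarrow> dist s' s \<ge> 2 * r"
    and "norm e \<le> 1" "norm v \<le> 1" "v \<bullet> (s - p) = 0"
    and y: "dist y s \<le> r / 7"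
  shows "patched e v p r S y = ramp e s y"
proof -
  have "ramp v p y = v \<bullet> (y - s)"
    using assms(7) by (simp add: ramp_def inner_diff_right)
  moreover have "\<bar>v \<bullet> (y - s)\<bar> \<le> norm (y - s)" "\<bar>e \<bullet> (y - s)\<bar> \<le> norm (y - s)"
    using Cauchy_Schwarz_ineq2[of v "y - s"] Cauchy_Schwarz_ineq2[of e "y - s"] assms(5,6)
    by (meson mult_left_le_one_le norm_ge_zero order_trans)+
  ultimately have "\<bar>ramp e s y - ramp v p y\<bar> \<le> 2 * norm (y - s)"
    unfolding ramp_def by linarith
  also have "\<dots> \<le> cone r s y"
    using y by (simp add: cone_def dist_norm)
  finally have close: "\<bar>ramp e s y - ramp v p y\<bar> \<le> cone r s y" .
  have far: "cone r s' y \<le> - cone r s y" "cone r s' y \<le> 0" if "s' \<in> S" "s' \<noteq> s" for s'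
    using sep[OF that] dist_triangle[of s' s y] y \<open>r > 0\<close>
    by (simp_all add: cone_def dist_commute field_simps)
  have "Max ((\<lambda>s'. max (ramp v p y) (min (ramp e s' y) (ramp v p y + cone r s' y))) ` S)
      = max (ramp v p y) (ramp e s y)"
  proof (rule Max_eqI)
    show "t \<le> max (ramp v p y) (ramp e s y)"
      if "t \<in> (\<lambda>s'. max (ramp v p y) (min (ramp e s' y) (ramp v p y + cone r s' y))) ` S" for t
      using that far(2) close by (smt (verit) imageE)
    show "max (ramp v p y) (ramp e s y)
        \<in> (\<lambda>s'. max (ramp v p y) (min (ramp e s' y) (ramp v p y + cone r s' y))) ` S"
      using close \<open>s \<in> S\<close> by (intro image_eqI[of _ _ s]) auto
  qed (use assms in auto)
  moreover have "Min ((\<lambda>s'. max (ramp e s' y) (ramp v p y - cone r s' y)) ` S) = ramp e s y"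
  proof (rule Min_eqI)
    show "ramp e s y \<le> t"
      if "t \<in> (\<lambda>s'. max (ramp e s' y) (ramp v p y - cone r s' y)) ` S" for t
      using that far(1) close by (smt (verit) imageE)
    show "ramp e s y \<in> (\<lambda>s'. max (ramp e s' y) (ramp v p y - cone r s' y)) ` S"
      using close \<open>s \<in> S\<close> by (intro image_eqI[of _ _ s]) auto
  qed (use assms in auto)
  ultimately show ?thesis
    unfolding patched_def by simp
qed

definition shows_ramp :: "'a::real_inner \<Rightarrow> 'a set \<Rightarrow> ('a \<Rightarrow> real) \<Rightarrow> bool"
  where "shows_ramp e S f \<longleftrightarrow> (\<forall>s\<in>S. \<forall>\<^sub>F y in nhds s. f y = ramp e s y)"

lemma finite_separated:
  fixes S :: "'a::metric_space set"
  assumes "finite S"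
  obtains r where "r > 0" "\<And>s s'. s \<in> S \<Longrightarrow> s' \<in> S \<Longrightarrow> s' \<noteq> s \<Longrightarrow> dist s' s \<ge> 2 * r"
proof -
  have "uniform_discrete S"
    using assms by induction (simp_all add: uniform_discrete_insert)
  then obtain d where "d > 0" "\<And>s s'. s \<in> S \<Longrightarrow> s' \<in> S \<Longrightarrow> dist s s' < d \<Longrightarrow> s = s'"
    unfolding uniform_discrete_def by blast
  with that[of "d / 2"] show ?thesis
    by (force simp: not_less[symmetric])
qed

lemma patched_shows_ramp:
  assumes "finite S" "r > 0"
    and "\<And>s s'. s \<in> S \<Longrightarrow> s' \<in> S \<Longrightarrow> s' \<noteq> s \<Longrightarrow> dist s' s \<ge> 2 * r"
    and "norm e \<le> 1" "norm v \<le> 1" "\<And>s. s \<in> S \<Longrightarrow> v \<bullet> (s - p) = 0"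
  shows "shows_ramp e S (patched e v p r S)"
  unfolding shows_ramp_def eventually_nhds_metric
proof (intro ballI exI[of _ "r / 7"] conjI allI impI)
  show "patched e v p r S y = ramp e s y" if "s \<in> S" "dist y s < r / 7" for s y
    using patched_near[of S s r e v p y] assms that by (auto simp: less_imp_le)
qed (use \<open>r > 0\<close> in simp)

section \<open>From increments to Goldstein subdifferentials\<close>

lemma Rn_iff: "x \<in> Rn n \<longleftrightarrow> (\<forall>k\<ge>n. Poly_Mapping.lookup x k = 0)"
  unfolding Rn_def by (force simp: in_keys_iff not_less[symmetric])

lemma subspace_Rn: "subspace (Rn n)"
  by (auto simp: subspace_def Rn_iff lookup_add)

lemma single_in_Rn: "k < n \<Longrightarrow> Poly_Mapping.single k c \<in> Rn n"
  by (auto simp: Rn_iff lookup_single when_def)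

lemma inner_single_single:
  "Poly_Mapping.single j (a::real) \<bullet> Poly_Mapping.single k b = (if j = k then a * b else 0)"
  by (auto simp: inner_poly_mapping_def lookup_single when_def)

lemma norm_single_one: "norm (Poly_Mapping.single k (1::real)) = 1"
  by (simp add: norm_eq_sqrt_inner inner_single_single)

text \<open>
  The difference quotients of \<open>f\<close> along the ray from \<open>x\<close> in the direction \<open>w\<close> are at least \<open>m\<close>,
  and they tend to \<open>g \<bullet> w\<close> because the ray stays in \<open>Rn n\<close>.
\<close>

lemma gradient_inner_ge:
  assumes grad: "has_gradient n f x g" and "x \<in> Rn n" "w \<in> Rn n"
    and inc: "\<forall>\<^sub>F t in at_right 0. f x + m * t \<le> f (x + t *\<^sub>R w)"
  shows "m \<le> g \<bullet> w"
proof -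
  have ray: "((\<lambda>t. x + t *\<^sub>R w) has_derivative (\<lambda>t. t *\<^sub>R w)) (at_right 0)"
    by (auto intro!: derivative_eq_intros)
  have sub: "(\<lambda>t. x + t *\<^sub>R w) ` {0<..} \<subseteq> Rn n"
    using assms(2,3) subspace_Rn[of n] by (auto intro: subspace_add subspace_scale)
  have "(f has_derivative (\<lambda>h. g \<bullet> h)) (at (x + 0 *\<^sub>R w) within (\<lambda>t. x + t *\<^sub>R w) ` {0<..})"
    using grad sub unfolding has_gradient_def by (auto intro: has_derivative_subset)
  from has_derivative_in_compose[OF ray this]
  have "((\<lambda>t. f (x + t *\<^sub>R w)) has_real_derivative g \<bullet> w) (at_right 0)"
    by (simp add: has_field_derivative_def mult_commute_abs)
  then have "((\<lambda>t. (f (x + t *\<^sub>R w) - f x) / t) \<longlongrightarrow> g \<bullet> w) (at_right 0)"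
    by (simp add: has_field_derivative_iff)
  moreover have "\<forall>\<^sub>F t in at_right 0. m \<le> (f (x + t *\<^sub>R w) - f x) / t"
    using inc eventually_at_right_less[of "0::real"]
    by eventually_elim (simp add: field_simps)
  ultimately show ?thesis
    by (intro tendsto_lowerbound) auto
qed

text \<open>
  The increment condition concerns an open ball, because the gradients that define the Clarke
  subdifferential at \<open>y\<close> are taken at points near \<open>y\<close>.
\<close>

lemma clarke_inner_ge:
  assumes s: "s \<in> clarke n f y" and y: "dist y x < \<rho>" and w: "w \<in> Rn n"
    and inc: "\<And>z t. dist z x < \<rho> \<Longrightarrow> t > 0 \<Longrightarrow> dist (z + t *\<^sub>R w) x < \<rho> \<Longrightarrow> f z + m * t \<le> f (z + t *\<^sub>R w)"
  shows "m \<le> s \<bullet> w"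
proof -
  have "m \<le> l \<bullet> w"
    if X: "\<And>k. X k \<in> Rn n" "\<And>k. has_gradient n f (X k) (G k)" "X \<longlonglongrightarrow> y" and G: "G \<longlonglongrightarrow> l"
    for X G l
  proof -
    have "\<forall>\<^sub>F k in sequentially. dist (X k) x < \<rho>"
      using order_tendstoD(2)[OF tendsto_dist[OF X(3) tendsto_const] y] .
    then have "\<forall>\<^sub>F k in sequentially. m \<le> G k \<bullet> w"
    proof eventually_elim
      case (elim k)
      have "((\<lambda>t. dist (X k + t *\<^sub>R w) x) \<longlongrightarrow> dist (X k + 0 *\<^sub>R w) x) (at_right 0)"
        by (intro tendsto_intros)
      then have "\<forall>\<^sub>F t in at_right 0. dist (X k + t *\<^sub>R w) x < \<rho>"
        using elim order_tendstoD(2) by fastforce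
      with eventually_at_right_less[of "0::real"]
      have "\<forall>\<^sub>F t in at_right 0. f (X k) + m * t \<le> f (X k + t *\<^sub>R w)"
        by eventually_elim (auto intro: inc elim)
      then show ?case
        by (rule gradient_inner_ge[OF X(2) X(1) w])
    qed
    with tendsto_inner[OF G tendsto_const] show ?thesis
      by (intro tendsto_lowerbound) auto
  qed
  then have "clarke n f y \<subseteq> {s. s \<bullet> w \<ge> m}"
    unfolding clarke_def
    by (intro hull_minimal) (auto simp: convex_halfspace_ge inner_commute[of _ w])
  with s show ?thesis
    by blast
qed

text \<open>
  The gradient in the second assumption makes the subdifferential nonempty; \<open>infdist\<close> from an
  empty set would be \<open>0\<close>.
\<close>

lemma infdist_goldstein_ge:
  assumes "x \<in> Rn n" "has_gradient n f x g" "\<delta> \<ge> 0" "\<delta> < \<rho>" "w \<in> Rn n"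
    and inc: "\<And>z t. dist z x < \<rho> \<Longrightarrow> t > 0 \<Longrightarrow> dist (z + t *\<^sub>R w) x < \<rho> \<Longrightarrow> f z + m * t \<le> f (z + t *\<^sub>R w)"
    and b: "b > 0" "norm w \<le> b"
  shows "m / b \<le> infdist 0 (goldstein n \<delta> f x)"
proof -
  have "g \<in> clarke n f x"
    unfolding clarke_def using assms(1,2)
    by (intro hull_inc CollectI conjI exI[of _ "\<lambda>_. x"] exI[of _ "\<lambda>_. g"])
      (auto simp: has_gradient_def)
  then have "g \<in> goldstein n \<delta> f x"
    unfolding goldstein_def using assms(1,3) by (intro hull_inc) auto
  then have ne: "goldstein n \<delta> f x \<noteq> {}"
    by blast
  have "goldstein n \<delta> f x \<subseteq> {s. s \<bullet> w \<ge> m}"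
    unfolding goldstein_def
  proof (rule hull_minimal)
    show "(\<Union>y\<in>cball x \<delta> \<inter> Rn n. clarke n f y) \<subseteq> {s. s \<bullet> w \<ge> m}"
      using clarke_inner_ge[OF _ _ assms(5) inc] assms(4) by (force simp: dist_commute)
  qed (simp add: convex_halfspace_ge inner_commute[of _ w])
  then have "m / b \<le> dist 0 s" if "s \<in> goldstein n \<delta> f x" for s
  proof -
    have "m \<le> s \<bullet> w"
      using \<open>goldstein n \<delta> f x \<subseteq> _\<close> that by blast
    also have "\<dots> \<le> norm s * norm w"
      by (rule norm_cauchy_schwarz)
    also have "\<dots> \<le> norm s * b"
      using b by (intro mult_left_mono) auto
    finally show ?thesis
      using b by (simp add: field_simps)
  qed
  with ne show ?thesis
    by (auto simp: infdist_def intro: cINF_greatest)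
qed

section \<open>A hidden direction\<close>

text \<open>
  The \<open>n\<close> unit vectors are independent, so one of them lies outside the span of \<open>B\<close>; its
  component orthogonal to that span is not zero.
\<close>

lemma exists_unit_orthogonal:
  assumes "finite B" "B \<subseteq> Rn n" "card B < n"
  obtains v where "v \<in> Rn n" "norm v = 1" "\<And>b. b \<in> B \<Longrightarrow> v \<bullet> b = 0"
proof -
  define E where "E = (\<lambda>k. Poly_Mapping.single k (1::real)) ` {..<n}"
  have inj: "inj_on (\<lambda>k. Poly_Mapping.single k (1::real)) {..<n}"
    by (intro inj_onI) (metis inner_single_single mult_1 zero_neq_one)
  have E: "independent E"
  proof (rule pairwise_orthogonal_independent)
    show "pairwise orthogonal E"
      by (auto simp: E_def pairwise_def orthogonal_def inner_single_single)
    show "0 \<notin> E"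
      by (auto simp: E_def) (metis norm_single_one norm_zero zero_neq_one)
  qed
  have "\<not> E \<subseteq> span B"
    using independent_span_bound[OF \<open>finite B\<close> E] assms(3) card_image[OF inj]
    by (auto simp: E_def)
  then obtain e where e: "e \<in> E" "e \<notin> span B"
    by blast
  obtain D where D: "finite D" "span D = span B" "pairwise orthogonal D"
    using basis_orthogonal[OF \<open>finite B\<close>] by blast
  define u where "u = e - (\<Sum>d\<in>D. ((d \<bullet> e) / (d \<bullet> d)) *\<^sub>R d)"
  have proj: "(\<Sum>d\<in>D. ((d \<bullet> e) / (d \<bullet> d)) *\<^sub>R d) \<in> span B"
    unfolding D(2)[symmetric] by (intro span_sum span_scale span_base)
  have "span B \<subseteq> Rn n"
    using assms(2) by (intro span_minimal subspace_Rn)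
  moreover have "e \<in> Rn n"
    using e(1) by (auto simp: E_def single_in_Rn)
  ultimately have "u \<in> Rn n"
    unfolding u_def using proj by (intro subspace_diff[OF subspace_Rn]) auto
  have "u \<noteq> 0"
    using e(2) proj by (auto simp: u_def)
  have "u \<bullet> d = 0" if "d \<in> D" for d
  proof -
    have "(\<Sum>c\<in>D. ((c \<bullet> e) / (c \<bullet> c)) *\<^sub>R c) \<bullet> d = (\<Sum>c\<in>D. if c = d then d \<bullet> e else 0)"
      unfolding inner_sum_left
    proof (rule sum.cong)
      fix c assume "c \<in> D"
      then show "((c \<bullet> e) / (c \<bullet> c)) *\<^sub>R c \<bullet> d = (if c = d then d \<bullet> e else 0)"
        using D(3) that by (cases "c = d") (auto simp: pairwise_def orthogonal_def)
    qed simp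
    also have "\<dots> = e \<bullet> d"
      using D(1) that by (simp add: inner_commute)
    finally show ?thesis
      by (simp add: u_def inner_diff_left)
  qed
  then have "span D \<subseteq> {x. u \<bullet> x = 0}"
    by (intro span_minimal) (auto simp: subspace_def inner_right_distrib)
  then have "u \<bullet> b = 0" if "b \<in> B" for b
    using that D(2) span_base[of b B] by blast
  then show ?thesis
    using \<open>u \<in> Rn n\<close> \<open>u \<noteq> 0\<close>
    by (intro that[of "u /\<^sub>R norm u"]) (auto intro: subspace_scale[OF subspace_Rn])
qed

text \<open>
  Only the differences of the points of \<open>S\<close> are constraints, one fewer than there are points; this
  leaves room for \<open>e\<close> in dimension \<open>card S + 1\<close>.
\<close>

lemma exists_hidden_direction:
  assumes "finite S" "S \<subseteq> Rn n" "p \<in> S" "e \<in> Rn n" "card S < n"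
  obtains v where "v \<in> Rn n" "norm v = 1" "v \<bullet> e = 0" "\<And>s. s \<in> S \<Longrightarrow> v \<bullet> (s - p) = 0"
proof -
  let ?B = "insert e ((\<lambda>s. s - p) ` (S - {p}))"
  have "card ?B \<le> Suc (card ((\<lambda>s. s - p) ` (S - {p})))"
    using assms(1) by (intro card_insert_le_m1) auto
  also have "card ((\<lambda>s. s - p) ` (S - {p})) \<le> card (S - {p})"
    using assms(1) by (intro card_image_le) auto
  also have "Suc (card (S - {p})) = card S"
    using card_Suc_Diff1[OF assms(1,3)] .
  finally have "card ?B < n"
    using assms(5) by simp
  moreover have "finite ?B" "?B \<subseteq> Rn n"
    using assms by (auto intro!: subspace_diff[OF subspace_Rn])
  ultimately obtain v where v: "v \<in> Rn n" "norm v = 1" "\<And>b. b \<in> ?B \<Longrightarrow> v \<bullet> b = 0"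
    using exists_unit_orthogonal by metis
  have "v \<bullet> (s - p) = 0" if "s \<in> S" for s
    using v(3)[of "s - p"] that by (cases "s = p") auto
  with v that show ?thesis
    by blast
qed

section \<open>Hard functions for a given set of queries\<close>

text \<open>
  The number \<open>3/4\<close> is the inverse of the Lipschitz constant \<open>4/3\<close> of \<open>patched\<close>: this function
  vanishes on \<open>S\<close>, so it stays within the cut-off levels \<open>-1\<close> and \<open>1\<close> at distance less than
  \<open>3/4\<close> from \<open>S\<close>. The number \<open>1/3\<close> is the growth rate \<open>1/2\<close> along \<open>e + v\<close> divided by the upper
  bound \<open>3/2\<close> for the length \<open>sqrt 2\<close> of this vector.
\<close>

lemma exists_hard_function:
  assumes S: "finite S" "S \<noteq> {}" "S \<subseteq> Rn n" "card S < n"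
    and e: "e \<in> Rn n" "norm e = 1" and \<delta>: "0 \<le> \<delta>" "\<delta> < 3/4"
  obtains f where "(4/3)-lipschitz_on UNIV f" "\<And>x. \<bar>f x\<bar> \<le> 1" "shows_ramp e S f"
    "\<And>s. s \<in> S \<Longrightarrow> 1/3 \<le> infdist 0 (goldstein n \<delta> f s)"
proof -
  obtain p where p: "p \<in> S"
    using S(2) by blast
  obtain v where v: "v \<in> Rn n" "norm v = 1" "v \<bullet> e = 0" "\<And>s. s \<in> S \<Longrightarrow> v \<bullet> (s - p) = 0"
    using exists_hidden_direction[OF S(1,3) p e(1) S(4)] by blast
  obtain r where r: "r > 0" "\<And>s s'. s \<in> S \<Longrightarrow> s' \<in> S \<Longrightarrow> s' \<noteq> s \<Longrightarrow> dist s' s \<ge> 2 * r"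
    using finite_separated[OF S(1)] by blast
  define h where "h = patched e v p r S"
  define f where "f x = max (-1) (min 1 (h x))" for x
  define w where "w = e + v"
  have lip: "(4/3)-lipschitz_on UNIV h"
    unfolding h_def using S e v by (intro patched_lipschitz) auto
  have ramp: "shows_ramp e S h"
    unfolding h_def using S e v r by (intro patched_shows_ramp) auto
  have f_eq: "f y = h y" if "s \<in> S" "dist y s < 3/4" for s y
  proof -
    have "h s = 0"
      using ramp that(1) eventually_nhds_x_imp_x by (fastforce simp: shows_ramp_def ramp_def)
    then have "\<bar>h y\<bar> \<le> 4/3 * dist y s"
      using lipschitz_onD[OF lip, of y s] by (simp add: dist_real_def)
    with that(2) show ?thesis
      by (simp add: f_def)
  qed
  have "e \<bullet> e = 1" "v \<bullet> v = 1"
    using e v by (simp_all add: dot_square_norm)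
  then have ww: "w \<bullet> w = 2" "e \<bullet> w = 1" "v \<bullet> w = 1"
    using v(3) by (simp_all add: w_def inner_add inner_commute)
  then have norm_w: "norm w \<le> 3/2"
    by (subst norm_le_square) (simp_all add: power2_eq_square)
  \<comment> \<open>both ramps gain \<open>t\<close>, and the cones lose at most \<open>t * norm w / 3 \<le> t / 2\<close>\<close>
  have rate: "h z + 1/2 * t \<le> h (z + t *\<^sub>R w)" if "t > 0" for z t
  proof -
    have "t * norm w \<le> t * (3/2)"
      using that norm_w by (intro mult_left_mono) auto
    then show ?thesis
      unfolding h_def using that ww by (intro patched_increment S) auto
  qed
  have f_ramp: "shows_ramp e S f"
    unfolding shows_ramp_def
  proof
    fix s assume s: "s \<in> S"
    then have "\<forall>\<^sub>F y in nhds s. h y = ramp e s y"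
      using ramp by (simp add: shows_ramp_def)
    moreover have "\<forall>\<^sub>F y in nhds s. dist y s < 3/4"
      by (auto simp: eventually_nhds_metric intro!: exI[of _ "3/4"])
    ultimately show "\<forall>\<^sub>F y in nhds s. f y = ramp e s y"
      by eventually_elim (simp add: f_eq[OF s])
  qed
  show ?thesis
  proof (rule that[OF _ _ f_ramp])
    show "(4/3)-lipschitz_on UNIV f"
    proof (rule lipschitz_onI)
      show "dist (f x) (f y) \<le> 4/3 * dist x y" for x y
        using lipschitz_onD[OF lip, of x y, OF UNIV_I UNIV_I] unfolding f_def dist_real_def by linarith
    qed simp
    show "\<bar>f x\<bar> \<le> 1" for x
      by (simp add: f_def)
    fix s assume s: "s \<in> S"
    have "(1/2) / (3/2) \<le> infdist 0 (goldstein n \<delta> f s)"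
    proof (rule infdist_goldstein_ge[where w = w and \<rho> = "3/4"])
      show "s \<in> Rn n"
        using s S by blast
      show "w \<in> Rn n"
        unfolding w_def using e v by (intro subspace_add[OF subspace_Rn])
      have "((\<lambda>y. ramp e s y) has_derivative (\<lambda>h. e \<bullet> h)) (at s)"
        unfolding ramp_def by (auto intro!: derivative_eq_intros)
      moreover have "\<forall>\<^sub>F y in nhds s. ramp e s y = f y"
        using f_ramp s by (auto simp: shows_ramp_def eq_commute)
      then have "\<forall>\<^sub>F y in at s. ramp e s y = f y" "ramp e s s = f s"
        by (simp_all add: eventually_nhds_conv_at)
      ultimately have "(f has_derivative (\<lambda>h. e \<bullet> h)) (at s)"
        by (rule has_derivative_transform_eventually) simp
      then show "has_gradient n f s e"
        using e by (simp add: has_gradient_def has_derivative_at_withinI)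
      show "f z + 1/2 * t \<le> f (z + t *\<^sub>R w)"
        if "dist z s < 3/4" "t > 0" "dist (z + t *\<^sub>R w) s < 3/4" for z t
        using rate[OF that(2)] f_eq[OF s that(1)] f_eq[OF s that(3)] by simp
    qed (use \<delta> norm_w in auto)
    then show "1/3 \<le> infdist 0 (goldstein n \<delta> f s)"
      by simp
  qed
qed

section \<open>Leading the algorithm\<close>

lemma iterate_in_Rn:
  assumes "A \<in> det_algorithms orc" "n \<ge> 1" "is_lipschitz n F" "t \<ge> 1"
  shows "A n F t \<in> Rn n"
  using assms(1)[unfolded det_algorithms_def, THEN CollectD, THEN spec, THEN mp, OF assms(2),
      THEN conjunct1, THEN spec, THEN mp, OF assms(3), THEN spec, THEN mp, OF assms(4)] .

text \<open>
  The oracle answers for \<open>F\<close> and \<open>G\<close> agree near each of the common queries, on balls whose radii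
  depend on the query; finitely many queries admit a common radius, as the definition of
  deterministic algorithms demands. The neighbourhoods are those of the iterates of \<open>F\<close>: that
  \<open>G\<close> is queried there too is part of the conclusion.
\<close>

lemma same_ramp_same_iterates:
  assumes orc: "local_oracle orc" and A: "A \<in> det_algorithms orc" and "n \<ge> 1"
    and F: "is_lipschitz n F" "shows_ramp e (A n F ` {1..t}) F"
    and G: "is_lipschitz n G" "shows_ramp e (A n F ` {1..t}) G"
    and j: "j \<in> {1..t + 1}"
  shows "A n G j = A n F j"
proof -
  have answer: "\<forall>\<^sub>F y in nhds x. y \<in> Rn n \<longrightarrow> orc n H x y = H y" if x: "x \<in> Rn n" for H x
  proof -
    obtain \<nu> where "\<nu> > 0" "\<forall>y\<in>cball x \<nu> \<inter> Rn n. H y = orc n H x y"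
      using orc[unfolded local_oracle_def, rule_format, OF \<open>n \<ge> 1\<close> x] by blast
    then show ?thesis
      by (auto simp: eventually_nhds_metric dist_commute intro!: exI[of _ \<nu>])
  qed
  have "\<forall>\<^sub>F \<nu> in at_right 0. \<forall>y\<in>cball (A n F i) \<nu> \<inter> Rn n.
      orc n F (A n F i) y = orc n G (A n F i) y" if i: "i \<in> {1..t}" for i
  proof -
    let ?x = "A n F i"
    have x: "?x \<in> Rn n"
      using i by (intro iterate_in_Rn[OF A \<open>n \<ge> 1\<close> F(1)]) simp
    have "\<forall>\<^sub>F y in nhds ?x. F y = ramp e ?x y" "\<forall>\<^sub>F y in nhds ?x. G y = ramp e ?x y"
      using F(2) G(2) i by (auto simp: shows_ramp_def)
    with answer[OF x, of F] answer[OF x, of G]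
    have "\<forall>\<^sub>F y in nhds ?x. y \<in> Rn n \<longrightarrow> orc n F ?x y = orc n G ?x y"
      by eventually_elim auto
    then obtain d where "d > 0" "\<And>y. dist y ?x < d \<Longrightarrow> y \<in> Rn n \<Longrightarrow> orc n F ?x y = orc n G ?x y"
      unfolding eventually_nhds_metric by blast
    then show ?thesis
      by (auto simp: eventually_at_right_field dist_commute intro!: exI[of _ d])
  qed
  then have "\<forall>\<^sub>F \<nu> in at_right 0. \<forall>i\<in>{1..t}. \<forall>y\<in>cball (A n F i) \<nu> \<inter> Rn n.
      orc n F (A n F i) y = orc n G (A n F i) y"
    by (intro eventually_ball_finite) auto
  with eventually_at_right_less[of "0::real"]
  have "\<forall>\<^sub>F \<nu> in at_right 0. \<nu> > 0 \<and> (\<forall>i\<in>{1..t}. \<forall>y\<in>cball (A n F i) \<nu> \<inter> Rn n.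
      orc n F (A n F i) y = orc n G (A n F i) y)"
    by eventually_elim auto
  then have "\<exists>\<nu>>0. \<forall>i\<in>{1..t}. \<forall>y\<in>cball (A n F i) \<nu> \<inter> Rn n.
      orc n F (A n F i) y = orc n G (A n F i) y"
    by (rule eventually_happens'[OF trivial_limit_at_right_real])
  then have "\<forall>j\<in>{1..t + 1}. A n F j = A n G j"
    using A F(1) G(1) \<open>n \<ge> 1\<close> unfolding det_algorithms_def by blast
  with j show ?thesis
    by simp
qed

text \<open>
  A function that shows the ramp at its own first \<open>t\<close> iterates is replaced by one that shows it at
  the first \<open>t + 1\<close> of them; the replacement has the same first \<open>t + 1\<close> iterates, because
  the \<open>(t + 1)\<close>-st depends only on the germs at the first \<open>t\<close>. Patching the zero function, the
  case \<open>v = 0\<close>, works in every dimension.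
\<close>

lemma exists_leading_function:
  assumes "local_oracle orc" "A \<in> det_algorithms orc" "n \<ge> 1" "norm e = 1"
  shows "\<exists>F. is_lipschitz n F \<and> shows_ramp e (A n F ` {1..t}) F"
proof (induction t)
  case 0
  have "0-lipschitz_on (Rn n) (\<lambda>_. 0 :: real)"
    by (simp add: lipschitz_on_def)
  then show ?case
    by (auto simp: is_lipschitz_def shows_ramp_def)
next
  case (Suc t)
  then obtain F where F: "is_lipschitz n F" "shows_ramp e (A n F ` {1..t}) F"
    by blast
  let ?S = "A n F ` {1..Suc t}"
  obtain r where r: "r > 0" "\<And>s s'. s \<in> ?S \<Longrightarrow> s' \<in> ?S \<Longrightarrow> s' \<noteq> s \<Longrightarrow> dist s' s \<ge> 2 * r"
    using finite_separated[of ?S] by blast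
  let ?G = "patched e 0 0 r ?S"
  have G: "is_lipschitz n ?G"
    unfolding is_lipschitz_def using assms(4)
    by (intro exI[of _ "4/3"] patched_lipschitz) auto
  have ramp: "shows_ramp e ?S ?G"
    using r assms(4) by (intro patched_shows_ramp) auto
  have "shows_ramp e (A n F ` {1..t}) ?G"
    using ramp by (simp add: shows_ramp_def)
  then have "A n ?G j = A n F j" if "j \<in> {1..Suc t}" for j
    using same_ramp_same_iterates[OF assms(1-3) F G] that by simp
  then have "A n ?G ` {1..Suc t} = ?S"
    by (intro image_cong) auto
  then show ?case
    using G ramp by metis
qed

section \<open>The lower bound\<close>

lemma bounded_function_in_lip_class:
  assumes "n \<in> {1..d}" "L-lipschitz_on UNIV f" "L \<le> C" "\<And>x. \<bar>f x\<bar> \<le> 1" "2 \<le> C"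
  shows "(n, f) \<in> lip_class C d"
proof -
  have "ereal (-1) \<le> (INF x\<in>Rn n. ereal (f x))"
    using assms(4) by (intro INF_greatest) (metis abs_le_iff ereal_less_eq(3) minus_le_iff)
  then have "ereal (f 0) - (INF x\<in>Rn n. ereal (f x)) \<le> ereal (f 0) - ereal (-1)"
    by (intro ereal_minus_mono) auto
  also have "\<dots> \<le> ereal C"
    using assms(4)[of 0] assms(5) by simp
  finally show ?thesis
    using assms(1-3) lipschitz_on_subset[OF lipschitz_on_le[OF assms(2,3)], of "Rn n"]
    by (simp add: lip_class_def)
qed

theorem theorem3p4:
  fixes \<epsilon> \<delta> C :: real and T d :: nat
    and orc :: "nat \<Rightarrow> (vec \<Rightarrow> real) \<Rightarrow> vec \<Rightarrow> vec \<Rightarrow> real"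
  assumes "local_oracle orc"
    and "0 < \<epsilon>" "\<epsilon> < 1 / sqrt 17"
    and "0 < \<delta>" "\<delta> < 1 / sqrt 17"
    and "C \<ge> 6"
    and "T \<ge> 1" and "d \<ge> T + 1"
  shows "(INF A\<in>det_algorithms orc. SUP (n, f)\<in>lip_class C d.
            ereal (MIN t\<in>{1..T}. infdist 0 (goldstein n \<delta> f (A n f t)))) > ereal \<epsilon>"
proof -
  have "sqrt 17 \<ge> 4"
    by (intro real_le_rsqrt) simp
  then have "1 / sqrt 17 \<le> 1 / 4"
    by (intro divide_left_mono) auto
  with assms have small: "\<epsilon> < 1/3" "\<delta> < 3/4"
    by linarith+
  let ?val = "\<lambda>A n f. MIN t\<in>{1..T}. infdist 0 (goldstein n \<delta> f (A n f t))"
  have "ereal (1/3) \<le> (SUP (n, f)\<in>lip_class C d. ereal (?val A n f))"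
    if A: "A \<in> det_algorithms orc" for A
  proof -
    \<comment> \<open>\<open>T\<close> queries give \<open>T - 1\<close> differences; with \<open>e\<close> and the hidden direction this fills dimension \<open>T + 1\<close>\<close>
    define n where "n = T + 1"
    define e where "e = Poly_Mapping.single (0::nat) (1::real)"
    have e: "e \<in> Rn n" "norm e = 1"
      unfolding e_def n_def by (rule single_in_Rn, simp) (rule norm_single_one)
    have n: "n \<ge> 1" "n \<in> {1..d}"
      using assms by (auto simp: n_def)
    obtain F where F: "is_lipschitz n F" "shows_ramp e (A n F ` {1..T}) F"
      using exists_leading_function[OF assms(1) A n(1) e(2)] by blast
    let ?S = "A n F ` {1..T}"
    have "finite ?S" "?S \<noteq> {}"
      using assms(7) by auto
    moreover have "?S \<subseteq> Rn n"
      using iterate_in_Rn[OF A n(1) F(1)] by auto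
    moreover have "card ?S < n"
      using card_image_le[of "{1..T}" "A n F"] by (simp add: n_def)
    ultimately obtain f where f: "(4/3)-lipschitz_on UNIV f" "\<And>x. \<bar>f x\<bar> \<le> 1" "shows_ramp e ?S f"
      "\<And>s. s \<in> ?S \<Longrightarrow> 1/3 \<le> infdist 0 (goldstein n \<delta> f s)"
      using exists_hard_function[OF _ _ _ _ e less_imp_le[OF assms(4)] small(2)] by blast
    have "is_lipschitz n f"
      unfolding is_lipschitz_def using lipschitz_on_subset[OF f(1)] by blast
    then have "A n f t = A n F t" if "t \<in> {1..T}" for t
      using same_ramp_same_iterates[OF assms(1) A n(1) F _ f(3)] that by simp
    then have "1/3 \<le> ?val A n f"
      using f(4) assms(7) by (subst Min_ge_iff) auto
    moreover have "(n, f) \<in> lip_class C d"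
      using bounded_function_in_lip_class[OF n(2) f(1) _ f(2)] assms(6) by simp
    ultimately show ?thesis
      by (intro SUP_upper2[of "(n, f)"]) auto
  qed
  then have "ereal (1/3) \<le> (INF A\<in>det_algorithms orc. SUP (n, f)\<in>lip_class C d. ereal (?val A n f))"
    by (rule INF_greatest)
  moreover have "ereal \<epsilon> < ereal (1/3)"
    using small(1) by simp
  ultimately show ?thesis
    by (rule order_less_le_trans[rotated])
qed

end
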